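(* Let $B\subseteq \mathbb{N}^+$ be an infinite set which is highly sparse. Then for each $\alpha \in [0,1]$ there exists a set $A\subseteq \mathbb{N}^+$ such that $\mathsf{d}(A)=0$ and $\mathsf{d}(A+B)=\alpha$.
   Context: $\mathbb{N}^+=\{1,2,\ldots\}$. An infinite set $B\subseteq \mathbb{N}^+$ with increasing enumeration $(b_n: n \in \mathbb{N}^+)$ is highly sparse if $\lim_{n\to \infty} b_n/b_{n+1}=0$. For $S\subseteq \mathbb{N}^+$, the asymptotic density is $\mathsf{d}(S):=\lim_{n\to\infty} |S\cap[1,n]|/n$, provided the limit exists; "$\mathsf{d}(S)=\alpha$" means that the limit exists and equals $\alpha$. The sumset is $A+B:=\{x+y: x\in A, y\in B\}$. *)

theory Defs
  imports Complex_Main "HOL-Library.Infinite_Set" "HOL-Library.Set_Algebras"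
begin

text \<open>
  The positive integers are \<open>{1..} :: nat set\<close>, and the sumset is \<open>A + B\<close> as in
  \<^theory>\<open>HOL-Library.Set_Algebras\<close>.  The function \<^const>\<open>enumerate\<close> counts from \<open>0\<close>,
  so \<open>enumerate B n\<close> is the element usually written \<open>b\<^sub>n\<^sub>+\<^sub>1\<close>.
\<close>

definition highly_sparse :: "nat set \<Rightarrow> bool" where
  "highly_sparse B \<longleftrightarrow> infinite B \<and> B \<subseteq> {1..} \<and>
     (\<lambda>n. real (enumerate B n) / real (enumerate B (Suc n))) \<longlonglongrightarrow> 0"

definition has_density :: "nat set \<Rightarrow> real \<Rightarrow> bool" where
  "has_density S \<alpha> \<longleftrightarrow> (\<lambda>n. real (card (S \<inter> {1..n})) / real n) \<longlonglongrightarrow> \<alpha>"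

end

theory Submission
  imports Defs "HOL-Library.Nat_Bijection" "HOL-Library.Countable_Set"
begin

text \<open>
  Since \<open>B = {b\<^sub>0 < b\<^sub>1 < \<dots>}\<close> is highly sparse, there is a real \<open>\<theta>\<close> for which the fractional parts
  of \<open>\<theta> b\<^sub>n\<close> follow, with an error tending to \<open>0\<close> from above, any prescribed sequence \<open>t\<^sub>n\<close>; take
  \<open>t\<^sub>n\<close> dense in \<open>(0, \<alpha>)\<close>.  Then \<open>frac (\<theta> y)\<close> is equidistributed.  Let \<open>A\<close> consist of the \<open>x\<close> with
  \<open>frac (\<theta> x) < \<delta>(x)\<close>, where \<open>\<delta>\<close> decreases to \<open>0\<close> so slowly that the \<open>b\<^sub>n < y\<close> are
  \<open>\<delta>(y)\<close>-dense in \<open>(0, \<alpha>)\<close> under \<open>b \<mapsto> frac (\<theta> b)\<close>.  Then \<open>A\<close> has density \<open>0\<close>, while \<open>A + B\<close>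
  agrees up to density \<open>0\<close> with \<open>{y. frac (\<theta> y) < \<alpha>}\<close>, which has density \<open>\<alpha>\<close>.
\<close>

section \<open>Asymptotic density by linear bounds, and sets of density 0\<close>

text \<open>The constant \<open>C\<close> absorbs the finitely many \<open>n\<close> before
  convergence sets in. The bound then holds for every \<open>n\<close>, so several such estimates
  can be added without tracking thresholds.\<close>

lemma has_densityD:
  assumes "has_density S \<alpha>" "\<epsilon> > 0"
  obtains C where "\<And>n. \<bar>real (card (S \<inter> {1..n})) - \<alpha> * real n\<bar> \<le> \<epsilon> * real n + C"
proof -
  define f where "f = (\<lambda>n. real (card (S \<inter> {1..n})))"
  have "(\<lambda>n. f n / real n) \<longlonglongrightarrow> \<alpha>"
    using assms(1) unfolding has_density_def f_def .
  from LIMSEQ_D[OF this assms(2)]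
  obtain N where N: "\<And>n. n \<ge> N \<Longrightarrow> \<bar>f n / real n - \<alpha>\<bar> < \<epsilon>" by auto
  define C where "C = (\<Sum>n\<le>N. \<bar>f n - \<alpha> * real n\<bar>)"
  have "\<bar>f n - \<alpha> * real n\<bar> \<le> \<epsilon> * real n + C" for n
  proof (cases "n \<le> N")
    case True
    then have "\<bar>f n - \<alpha> * real n\<bar> \<le> C"
      unfolding C_def by (intro member_le_sum) auto
    with assms(2) show ?thesis
      by (smt (verit) mult_nonneg_nonneg of_nat_0_le_iff)
  next
    case False
    have "\<bar>f n - \<alpha> * real n\<bar> = \<bar>f n / real n - \<alpha>\<bar> * real n"
      using False by (simp add: abs_mult[symmetric] field_simps)
    also have "\<dots> \<le> \<epsilon> * real n"
      using N[of n] False by (intro mult_right_mono) auto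
    moreover have "C \<ge> 0"
      unfolding C_def by (intro sum_nonneg) auto
    ultimately show ?thesis by linarith
  qed
  with that show ?thesis unfolding f_def by blast
qed

text \<open>A bounded error vanishes after division by \<open>n\<close>. The two bounds are kept
  apart because for \<open>A + B\<close> they come from different inclusions.\<close>

lemma has_densityI:
  assumes upper: "\<And>\<epsilon>. \<epsilon> > 0 \<Longrightarrow> \<exists>C. \<forall>n. real (card (S \<inter> {1..n})) \<le> (\<alpha> + \<epsilon>) * real n + C"
    and lower: "\<And>\<epsilon>. \<epsilon> > 0 \<Longrightarrow> \<exists>C. \<forall>n. (\<alpha> - \<epsilon>) * real n - C \<le> real (card (S \<inter> {1..n}))"
  shows "has_density S \<alpha>"
  unfolding has_density_def
proof (rule LIMSEQ_I)
  fix r :: real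
  assume "r > 0"
  define f where "f = (\<lambda>n. real (card (S \<inter> {1..n})))"
  obtain C where C: "\<And>n. f n \<le> (\<alpha> + r / 2) * real n + C"
    using upper[of "r / 2"] \<open>r > 0\<close> unfolding f_def by auto
  obtain D where D: "\<And>n. (\<alpha> - r / 2) * real n - D \<le> f n"
    using lower[of "r / 2"] \<open>r > 0\<close> unfolding f_def by auto
  define E where "E = max 0 (max C D)"
  obtain N where N: "real N > 2 * E / r"
    using reals_Archimedean2 by blast
  have "\<bar>f n / real n - \<alpha>\<bar> < r" if "n \<ge> Suc N" for n
  proof -
    have "2 * E / r < real n" using N that by linarith
    then have "E < r / 2 * real n" using \<open>r > 0\<close> by (simp add: field_simps)
    moreover have "\<bar>f n - \<alpha> * real n\<bar> \<le> r / 2 * real n + E"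
      using C[of n] D[of n] unfolding E_def by (auto simp: algebra_simps abs_le_iff)
    ultimately have "\<bar>f n - \<alpha> * real n\<bar> < r * real n" by (simp add: field_simps)
    moreover have "\<bar>f n - \<alpha> * real n\<bar> = \<bar>f n / real n - \<alpha>\<bar> * real n"
      using that by (simp add: abs_mult[symmetric] field_simps)
    ultimately show ?thesis using that by simp
  qed
  then show "\<exists>no. \<forall>n\<ge>no. norm (real (card (S \<inter> {1..n})) / real n - \<alpha>) < r"
    unfolding f_def by auto
qed

lemma has_density_zeroI:
  assumes "\<And>\<epsilon>. \<epsilon> > 0 \<Longrightarrow> \<exists>C. \<forall>n. real (card (S \<inter> {1..n})) \<le> \<epsilon> * real n + C"
  shows "has_density S 0"
proof (rule has_densityI)
  fix \<epsilon> :: real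
  assume "\<epsilon> > 0"
  then show "\<exists>C. \<forall>n. real (card (S \<inter> {1..n})) \<le> (0 + \<epsilon>) * real n + C"
    using assms by simp
  have "(0 - \<epsilon>) * real n - 0 \<le> real (card (S \<inter> {1..n}))" for n
    using \<open>\<epsilon> > 0\<close> by (smt (verit) mult_nonpos_nonneg of_nat_0_le_iff)
  then show "\<exists>C. \<forall>n. (0 - \<epsilon>) * real n - C \<le> real (card (S \<inter> {1..n}))" by blast
qed

lemma has_density_zero_Un:
  assumes "has_density S 0" "has_density T 0"
  shows "has_density (S \<union> T) 0"
proof (rule has_density_zeroI)
  fix \<epsilon> :: real
  assume "\<epsilon> > 0"
  obtain C where C: "\<And>n. \<bar>real (card (S \<inter> {1..n})) - 0 * real n\<bar> \<le> \<epsilon> / 2 * real n + C"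
    using has_densityD[OF assms(1), of "\<epsilon> / 2"] \<open>\<epsilon> > 0\<close> by auto
  obtain D where D: "\<And>n. \<bar>real (card (T \<inter> {1..n})) - 0 * real n\<bar> \<le> \<epsilon> / 2 * real n + D"
    using has_densityD[OF assms(2), of "\<epsilon> / 2"] \<open>\<epsilon> > 0\<close> by auto
  have "real (card ((S \<union> T) \<inter> {1..n})) \<le> \<epsilon> * real n + (C + D)" for n
  proof -
    have "card ((S \<union> T) \<inter> {1..n}) \<le> card (S \<inter> {1..n}) + card (T \<inter> {1..n})"
      unfolding Int_Un_distrib2 by (rule card_Un_le)
    with C[of n] D[of n] show ?thesis by (simp add: field_simps)
  qed
  then show "\<exists>C. \<forall>n. real (card ((S \<union> T) \<inter> {1..n})) \<le> \<epsilon> * real n + C" by blast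
qed

lemma has_density_zero_UN:
  assumes "finite I" "\<And>i. i \<in> I \<Longrightarrow> has_density (S i) 0"
  shows "has_density (\<Union>i\<in>I. S i) 0"
  using assms
proof (induction I rule: finite_induct)
  case empty
  then show ?case by (simp add: has_density_def)
next
  case (insert i I)
  then show ?case by (simp add: has_density_zero_Un)
qed

lemma has_density_zero_translate:
  fixes S :: "nat set"
  assumes "has_density S 0" "S \<subseteq> {1..}"
  shows "has_density ((\<lambda>x. x + a) ` S) 0"
proof (rule has_density_zeroI)
  fix \<epsilon> :: real
  assume "\<epsilon> > 0"
  then obtain C where C: "\<And>n. \<bar>real (card (S \<inter> {1..n})) - 0 * real n\<bar> \<le> \<epsilon> * real n + C"
    using has_densityD[OF assms(1)] by blast
  have "real (card ((\<lambda>x. x + a) ` S \<inter> {1..n})) \<le> \<epsilon> * real n + C" for n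
  proof -
    have "(\<lambda>x. x + a) ` S \<inter> {1..n} \<subseteq> (\<lambda>x. x + a) ` (S \<inter> {1..n})"
      using assms(2) by auto
    then have "card ((\<lambda>x. x + a) ` S \<inter> {1..n}) \<le> card (S \<inter> {1..n})"
      by (meson card_image_le card_mono finite_Int finite_atLeastAtMost finite_imageI le_trans)
    with C[of n] show ?thesis by simp
  qed
  then show "\<exists>C. \<forall>n. real (card ((\<lambda>x. x + a) ` S \<inter> {1..n})) \<le> \<epsilon> * real n + C" by blast
qed

section \<open>Equidistribution of the fractional parts of multiples of \<theta>\<close>

lemma frac_eqI:
  fixes x y :: real
  assumes "0 \<le> y" "y < 1" "x - y \<in> \<int>"
  shows "frac x = y"
  using assms frac_unique_iff by blast

text \<open>
  Shifting by \<open>m\<close> moves the fractional parts by \<open>\<delta> = frac (\<theta> m)\<close>, so the intervals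
  \<open>[k\<delta>, (k + 1)\<delta>)\<close> are visited equally often up to a bounded error.
\<close>

lemma card_frac_less_multiple:
  fixes \<theta> :: real and m n :: nat
  defines "\<delta> \<equiv> frac (\<theta> * real m)"
    and "L \<equiv> (\<lambda>x. real (card ({y. frac (\<theta> * real y) < x} \<inter> {1..n})))"
  shows "L (real k * \<delta>) \<le> real k * L \<delta> + real (k * k) * real m"
    and "real k * \<delta> \<le> 1 \<Longrightarrow> real k * L \<delta> - real (k * k) * real m \<le> L (real k * \<delta>)"
proof -
  define J where "J = (\<lambda>k::nat. {y. real k * \<delta> \<le> frac (\<theta> * real y) \<and>
    frac (\<theta> * real y) < real (Suc k) * \<delta>} \<inter> {1..n})"
  have \<delta>: "0 \<le> \<delta>" "\<delta> < 1" unfolding \<delta>_def by (auto simp: frac_lt_1)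
  have int: "\<theta> * real m - \<delta> \<in> \<int>" unfolding \<delta>_def by (simp add: frac_def)
  have int': "\<theta> * real y - frac (\<theta> * real y) \<in> \<int>" for y :: nat by (simp add: frac_def)
  have L_Suc: "L (real (Suc k) * \<delta>) = L (real k * \<delta>) + real (card (J k))" for k
  proof -
    have "{y. frac (\<theta> * real y) < real (Suc k) * \<delta>} \<inter> {1..n} =
        ({y. frac (\<theta> * real y) < real k * \<delta>} \<inter> {1..n}) \<union> J k"
      unfolding J_def using \<delta> by (auto simp: algebra_simps)
    moreover have "card (({y. frac (\<theta> * real y) < real k * \<delta>} \<inter> {1..n}) \<union> J k) =
        card ({y. frac (\<theta> * real y) < real k * \<delta>} \<inter> {1..n}) + card (J k)"
      by (rule card_Un_disjoint) (auto simp: J_def)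
    ultimately show ?thesis unfolding L_def by simp
  qed
  \<comment> \<open>Subtracting \<open>m\<close> maps \<open>J (Suc k)\<close> into
    \<open>J k\<close>, except for the at most \<open>m\<close> elements \<open>y \<le> m\<close>.
    The fractional part of an element of \<open>J (Suc k)\<close> is at least \<delta>, so there is
    no wrap-around modulo 1.\<close>
  have up: "card (J (Suc k)) \<le> card (J k) + m" for k
  proof -
    have "J (Suc k) \<subseteq> (\<lambda>y. y + m) ` J k \<union> {1..m}"
    proof
      fix y assume y: "y \<in> J (Suc k)"
      show "y \<in> (\<lambda>y. y + m) ` J k \<union> {1..m}"
      proof (cases "y \<le> m")
        case False
        have "\<theta> * real (y - m) - (frac (\<theta> * real y) - \<delta>)
            = (\<theta> * real y - frac (\<theta> * real y)) - (\<theta> * real m - \<delta>)"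
          using False by (simp add: of_nat_diff algebra_simps)
        also have "\<dots> \<in> \<int>" using int' int by (rule Ints_diff)
        finally have Z: "\<theta> * real (y - m) - (frac (\<theta> * real y) - \<delta>) \<in> \<int>" .
        have "real k * \<delta> + \<delta> \<le> frac (\<theta> * real y)" "real k * \<delta> \<ge> 0"
          using y \<delta> by (auto simp: J_def algebra_simps)
        then have "frac (\<theta> * real (y - m)) = frac (\<theta> * real y) - \<delta>"
          using \<delta> frac_lt_1[of "\<theta> * real y"] Z by (intro frac_eqI) linarith+
        then have "y - m \<in> J k"
          using y False by (auto simp: J_def algebra_simps)
        then show ?thesis using False by (auto intro!: image_eqI[of _ _ "y - m"])
      qed (use y in \<open>auto simp: J_def\<close>)
    qed
    then have "card (J (Suc k)) \<le> card ((\<lambda>y. y + m) ` J k \<union> {1..m})"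
      by (intro card_mono) (auto simp: J_def)
    also have "\<dots> \<le> card ((\<lambda>y. y + m) ` J k) + card {1..m}" by (rule card_Un_le)
    also have "\<dots> = card (J k) + m" by (simp add: card_image)
    finally show ?thesis .
  qed
  \<comment> \<open>Adding \<open>m\<close> loses only the last \<open>m\<close> numbers up to
    \<open>n\<close>. The assumption keeps the shifted interval inside \<open>[0, 1]\<close>, which
    excludes wrap-around.\<close>
  have down: "card (J k) \<le> card (J (Suc k)) + m" if "real (Suc (Suc k)) * \<delta> \<le> 1" for k
  proof -
    have "J k \<subseteq> (\<lambda>y. y - m) ` (J (Suc k) \<inter> {m<..}) \<union> {n - m<..n}"
    proof
      fix y assume y: "y \<in> J k"
      show "y \<in> (\<lambda>y. y - m) ` (J (Suc k) \<inter> {m<..}) \<union> {n - m<..n}"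
      proof (cases "y + m \<le> n")
        case True
        have "\<theta> * real (y + m) - (frac (\<theta> * real y) + \<delta>)
            = (\<theta> * real y - frac (\<theta> * real y)) + (\<theta> * real m - \<delta>)"
          by (simp add: algebra_simps)
        also have "\<dots> \<in> \<int>" using int' int by (rule Ints_add)
        finally have "frac (\<theta> * real (y + m)) = frac (\<theta> * real y) + \<delta>"
          using y \<delta> that by (intro frac_eqI) (auto simp: J_def algebra_simps)
        then have "y + m \<in> J (Suc k) \<inter> {m<..}"
          using y True by (auto simp: J_def algebra_simps)
        then show ?thesis by (auto intro!: image_eqI[of _ _ "y + m"])
      qed (use y in \<open>auto simp: J_def\<close>)
    qed
    then have "card (J k) \<le> card ((\<lambda>y. y - m) ` (J (Suc k) \<inter> {m<..}) \<union> {n - m<..n})"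
      by (intro card_mono) (auto simp: J_def)
    also have "\<dots> \<le> card ((\<lambda>y. y - m) ` (J (Suc k) \<inter> {m<..})) + card {n - m<..n}"
      by (rule card_Un_le)
    also have "\<dots> \<le> card (J (Suc k)) + m"
    proof (rule add_mono)
      have "card ((\<lambda>y. y - m) ` (J (Suc k) \<inter> {m<..})) \<le> card (J (Suc k) \<inter> {m<..})"
        by (rule card_image_le) (simp add: J_def)
      also have "\<dots> \<le> card (J (Suc k))" by (rule card_mono) (auto simp: J_def)
      finally show "card ((\<lambda>y. y - m) ` (J (Suc k) \<inter> {m<..})) \<le> card (J (Suc k))" .
    qed simp
    finally show ?thesis .
  qed
  have J0: "real (card (J 0)) = L \<delta>"
    unfolding J_def L_def by simp
  have Jup: "real (card (J k)) \<le> L \<delta> + real k * real m" for k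
  proof (induction k)
    case (Suc k)
    have "real (card (J (Suc k))) \<le> real (card (J k)) + real m" using up[of k] by linarith
    with Suc show ?case by (simp add: algebra_simps)
  qed (simp add: J0)
  have Jdown: "L \<delta> \<le> real (card (J k)) + real k * real m" if "real (Suc k) * \<delta> \<le> 1" for k
    using that
  proof (induction k)
    case (Suc k)
    have "real (card (J k)) \<le> real (card (J (Suc k))) + real m" using down[of k] Suc.prems by linarith
    moreover have "L \<delta> \<le> real (card (J k)) + real k * real m"
      using Suc \<delta> by (auto simp: algebra_simps)
    ultimately show ?case by (simp add: algebra_simps)
  qed (simp add: J0)
  have L0: "L 0 = 0" unfolding L_def by (simp add: not_less[THEN iffD2])
  \<comment> \<open>The interval with index \<open>i\<close> contributes an error of at most
    \<open>i * m\<close>; over all \<open>i < k\<close> these sum to at most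
    \<open>k * k * m\<close>.\<close>
  show "L (real k * \<delta>) \<le> real k * L \<delta> + real (k * k) * real m"
  proof (induction k)
    case (Suc k)
    have "real m \<ge> 0" "real k * real m \<ge> 0" by auto
    moreover have "real (Suc k) * L \<delta> + real (Suc k * Suc k) * real m =
        real k * L \<delta> + real (k * k) * real m + L \<delta> + 2 * (real k * real m) + real m"
      by (simp add: algebra_simps)
    ultimately show ?case unfolding L_Suc using Suc Jup[of k] by linarith
  qed (simp add: L0)
  show "real k * L \<delta> - real (k * k) * real m \<le> L (real k * \<delta>)" if "real k * \<delta> \<le> 1"
    using that
  proof (induction k)
    case (Suc k)
    have "real m \<ge> 0" "real k * real m \<ge> 0" "real k * \<delta> \<le> 1"
      using Suc.prems \<delta> by (auto simp: algebra_simps)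
    moreover have "real (Suc k) * L \<delta> - real (Suc k * Suc k) * real m =
        real k * L \<delta> - real (k * k) * real m + L \<delta> - 2 * (real k * real m) - real m"
      by (simp add: algebra_simps)
    moreover have "real k * L \<delta> - real (k * k) * real m \<le> L (real k * \<delta>)"
      using Suc.IH calculation(3) by blast
    ultimately show ?case unfolding L_Suc using Jdown[OF Suc.prems] by linarith
  qed (simp add: L0)
qed

text \<open>For a small fractional part \<delta>, about \<open>1 / \<delta>\<close> intervals of
  length \<delta> fill \<open>[0, 1)\<close>, which captures all \<open>n\<close> numbers; hence
  each holds about \<open>\<delta> * n\<close> of them. About \<open>\<beta> / \<delta>\<close> such
  intervals fill \<open>[0, \<beta>)\<close>. The hypothesis \<open>small\<close> expresses the
  irrationality of \<theta> in the form used here.\<close>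

lemma has_density_frac_less:
  fixes \<theta> \<beta> :: real
  assumes small: "\<And>\<epsilon>. \<epsilon> > 0 \<Longrightarrow> \<exists>m::nat. 0 < frac (\<theta> * real m) \<and> frac (\<theta> * real m) < \<epsilon>"
    and \<beta>: "0 \<le> \<beta>" "\<beta> \<le> 1"
  shows "has_density {y. frac (\<theta> * real y) < \<beta>} \<beta>"
proof -
  define L where "L = (\<lambda>n x. real (card ({y. frac (\<theta> * real y) < x} \<inter> {1..n})))"
  have "\<exists>C. \<forall>n. L n \<beta> \<le> (\<beta> + \<epsilon>) * real n + C \<and> (\<beta> - \<epsilon>) * real n - C \<le> L n \<beta>"
    if "\<epsilon> > 0" for \<epsilon>
  proof -
    \<comment> \<open>The bound 1/2 gives \<open>(\<beta> + 4 * \<delta>) * (1 - \<delta>) \<ge>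
      \<beta> + \<delta>\<close>, and \<epsilon>/4 makes the loss \<open>4 * \<delta>\<close>
      smaller than \<epsilon>.\<close>
    obtain m :: nat where m: "0 < frac (\<theta> * real m)" "frac (\<theta> * real m) < min (1/2) (\<epsilon> / 4)"
      using small[of "min (1/2) (\<epsilon> / 4)"] \<open>\<epsilon> > 0\<close> by auto
    define \<delta> where "\<delta> = frac (\<theta> * real m)"
    have \<delta>: "0 < \<delta>" "\<delta> < 1/2" "4 * \<delta> < \<epsilon>" using m unfolding \<delta>_def by auto
    define K where "K = nat \<lfloor>1 / \<delta>\<rfloor>"
    define k where "k = nat \<lfloor>\<beta> / \<delta>\<rfloor>"
    have "real K \<le> 1 / \<delta>" "1 / \<delta> < real K + 1" "real k \<le> \<beta> / \<delta>" "\<beta> / \<delta> < real k + 1"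
      unfolding K_def k_def using \<delta> \<beta> by (auto simp: of_nat_nat)
    then have K: "real K * \<delta> \<le> 1" "1 < real (Suc K) * \<delta>" and k: "real k * \<delta> \<le> \<beta>" "\<beta> < real (Suc k) * \<delta>"
      using \<delta> by (auto simp: field_simps)
    \<comment> \<open>One constant, independent of \<open>n\<close>, dominates the errors
      \<open>i * i * m\<close> for all \<open>i\<close> up to \<open>K + 1\<close> or
      \<open>k + 1\<close>.\<close>
    define C where "C = (real ((K + 1) * (K + 1)) + real ((k + 1) * (k + 1))) * real m"
    have "C \<ge> 0" unfolding C_def by simp
    have bounds: "L n \<beta> \<le> (\<beta> + \<epsilon>) * real n + 4 * C \<and>
        (\<beta> - \<epsilon>) * real n - 4 * C \<le> L n \<beta>" for n
    proof -
      define c where "c = L n \<delta>"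
      have "c \<ge> 0" unfolding c_def L_def by simp
      have mono: "L n x \<le> L n y" if "x \<le> y" for x y
        unfolding L_def using that by (auto intro!: card_mono)
      have "{y. frac (\<theta> * real y) < 1} = UNIV" by (auto simp: frac_lt_1)
      then have L1: "L n 1 = real n" unfolding L_def by simp
      have up: "L n (real i * \<delta>) \<le> real i * c + C" if "i \<le> Suc K \<or> i \<le> Suc k" for i
      proof -
        have "i * i \<le> (K + 1) * (K + 1) + (k + 1) * (k + 1)"
          using that mult_le_mono[of i "K + 1" i "K + 1"] mult_le_mono[of i "k + 1" i "k + 1"] by auto
        then have "real (i * i) * real m \<le> C"
          unfolding C_def of_nat_add[symmetric] by (intro mult_right_mono of_nat_mono) auto
        then show ?thesis
          using card_frac_less_multiple(1)[of \<theta> i m n] unfolding L_def c_def \<delta>_def by linarith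
      qed
      have down: "real i * c - C \<le> L n (real i * \<delta>)" if "i \<le> K \<or> i \<le> k" "real i * \<delta> \<le> 1" for i
      proof -
        have "i * i \<le> (K + 1) * (K + 1) + (k + 1) * (k + 1)"
          using that mult_le_mono[of i "K + 1" i "K + 1"] mult_le_mono[of i "k + 1" i "k + 1"] by auto
        then have "real (i * i) * real m \<le> C"
          unfolding C_def of_nat_add[symmetric] by (intro mult_right_mono of_nat_mono) auto
        then show ?thesis
          using card_frac_less_multiple(2)[of i \<theta> m n] that(2) unfolding L_def c_def \<delta>_def by linarith
      qed
      have n_le: "real n \<le> real (Suc K) * c + C"
        using up[of "Suc K"] mono[of 1 "real (Suc K) * \<delta>"] K L1 by auto
      have n_ge: "real K * c - C \<le> real n"
        using down[of K] mono[of "real K * \<delta>" 1] K L1 by auto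
      have L_le: "L n \<beta> \<le> real (Suc k) * c + C"
        using up[of "Suc k"] mono[of \<beta> "real (Suc k) * \<delta>"] k by auto
      have L_ge: "real k * c - C \<le> L n \<beta>"
        using down[of k] mono[of "real k * \<delta>" \<beta>] k \<beta> by auto
      \<comment> \<open>Multiplying by \<delta> turns the number \<open>K\<close> of intervals into
        a length within \<delta> of 1. This bound and \<open>c_ge\<close> pin \<open>c\<close> to
        \<open>\<delta> * n\<close> up to factors close to 1 and a bounded error.\<close>
      have c_le: "(1 - \<delta>) * c \<le> \<delta> * (real n + C)"
      proof -
        have "(1 - \<delta>) * c \<le> (\<delta> * real K) * c"
          using K \<open>c \<ge> 0\<close> by (intro mult_right_mono) (auto simp: algebra_simps)
        also have "\<dots> \<le> \<delta> * (real n + C)"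
          unfolding mult.assoc using n_ge \<delta> by (intro mult_left_mono) auto
        finally show ?thesis .
      qed
      have c_ge: "\<delta> * (real n - C) \<le> (1 + \<delta>) * c"
      proof -
        have "\<delta> * (real n - C) \<le> \<delta> * (real (Suc K) * c)"
          using n_le \<delta> by (intro mult_left_mono) auto
        also have "\<dots> \<le> (1 + \<delta>) * c"
          unfolding mult.assoc[symmetric]
          using K \<open>c \<ge> 0\<close> by (intro mult_right_mono) (auto simp: algebra_simps)
        finally show ?thesis .
      qed
      have \<beta>\<delta>: "\<beta> * \<delta> \<le> \<delta>" "\<beta> * \<delta> \<ge> 0" "\<delta> * \<delta> \<le> \<delta> / 2" "\<delta> * \<delta> \<ge> 0"
        using \<beta> \<delta> mult_right_mono[of \<beta> 1 \<delta>] mult_right_mono[of \<delta> "1/2" \<delta>] by auto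
      have "L n \<beta> \<le> (\<beta> + \<epsilon>) * real n + 4 * C"
      proof -
        have "\<delta> * (L n \<beta> - C) \<le> (\<delta> * real (Suc k)) * c"
          unfolding mult.assoc using L_le \<delta> by (intro mult_left_mono) auto
        also have "\<dots> \<le> (\<beta> + \<delta>) * c"
          using k \<open>c \<ge> 0\<close> by (intro mult_right_mono) (auto simp: algebra_simps)
        also have "\<dots> \<le> ((\<beta> + 4 * \<delta>) * (1 - \<delta>)) * c"
          using \<beta>\<delta> \<open>c \<ge> 0\<close> by (intro mult_right_mono) (auto simp: algebra_simps)
        also have "\<dots> \<le> (\<beta> + 4 * \<delta>) * (\<delta> * (real n + C))"
          unfolding mult.assoc using c_le \<beta> \<delta> by (intro mult_left_mono) auto
        finally have "\<delta> * (L n \<beta> - C) \<le> \<delta> * ((\<beta> + 4 * \<delta>) * (real n + C))"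
          by (simp add: algebra_simps)
        then have "L n \<beta> - C \<le> (\<beta> + 4 * \<delta>) * (real n + C)"
          using \<delta> by (simp only: mult_le_cancel_left_pos)
        then have "L n \<beta> - C \<le> (\<beta> + 4 * \<delta>) * real n + (\<beta> + 4 * \<delta>) * C"
          by (simp only: distrib_left)
        moreover have "(\<beta> + 4 * \<delta>) * real n \<le> (\<beta> + \<epsilon>) * real n"
          using \<delta> by (intro mult_right_mono) auto
        moreover have "(\<beta> + 4 * \<delta>) * C \<le> 3 * C"
          using \<delta> \<beta> \<open>C \<ge> 0\<close> by (intro mult_right_mono) auto
        ultimately show ?thesis by linarith
      qed
      moreover have "(\<beta> - \<epsilon>) * real n - 4 * C \<le> L n \<beta>"
      \<comment> \<open>The main estimate multiplies \<open>c_ge\<close> by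
        \<open>\<beta> - 2 * \<delta>\<close>, which must be nonnegative; for smaller \<beta> the
        left-hand side is already at most 0.\<close>
      proof (cases "\<beta> < 2 * \<delta>")
        case True
        then have "(\<beta> - \<epsilon>) * real n \<le> 0"
          using \<delta> by (intro mult_nonpos_nonneg) auto
        moreover have "L n \<beta> \<ge> 0" unfolding L_def by simp
        ultimately show ?thesis using \<open>C \<ge> 0\<close> by linarith
      next
        case False
        have "\<delta> * ((\<beta> - 2 * \<delta>) * (real n - C)) = (\<beta> - 2 * \<delta>) * (\<delta> * (real n - C))"
          by simp
        also have "\<dots> \<le> ((\<beta> - 2 * \<delta>) * (1 + \<delta>)) * c"
          unfolding mult.assoc using c_ge False by (intro mult_left_mono) auto
        also have "\<dots> \<le> (\<beta> - \<delta>) * c"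
        proof (rule mult_right_mono)
          have "(\<beta> - 2 * \<delta>) * (1 + \<delta>) = \<beta> + \<beta> * \<delta> - 2 * \<delta> - 2 * (\<delta> * \<delta>)"
            by (simp add: algebra_simps)
          with \<beta>\<delta> show "(\<beta> - 2 * \<delta>) * (1 + \<delta>) \<le> \<beta> - \<delta>" by linarith
        qed (use \<open>c \<ge> 0\<close> in simp)
        also have "\<dots> \<le> (\<delta> * real k) * c"
          using k \<open>c \<ge> 0\<close> by (intro mult_right_mono) (auto simp: algebra_simps)
        also have "\<dots> \<le> \<delta> * (L n \<beta> + C)"
          unfolding mult.assoc using L_ge \<delta> by (intro mult_left_mono) auto
        finally have "(\<beta> - 2 * \<delta>) * (real n - C) \<le> L n \<beta> + C"
          using \<delta> by (simp only: mult_le_cancel_left_pos)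
        then have "(\<beta> - 2 * \<delta>) * real n - (\<beta> - 2 * \<delta>) * C \<le> L n \<beta> + C"
          by (simp only: right_diff_distrib)
        moreover have "(\<beta> - \<epsilon>) * real n \<le> (\<beta> - 2 * \<delta>) * real n"
          using \<delta> by (intro mult_right_mono) auto
        moreover have "(\<beta> - 2 * \<delta>) * C \<le> 1 * C"
          using \<delta> \<beta> \<open>C \<ge> 0\<close> by (intro mult_right_mono) auto
        ultimately show ?thesis using \<open>C \<ge> 0\<close> by linarith
      qed
      ultimately show ?thesis by blast
    qed
    then show ?thesis by blast
  qed
  then show ?thesis
    unfolding L_def by (intro has_densityI) blast+
qed

section \<open>Consequences of sparseness: density 0 and the choice of \<theta>\<close>

text \<open>Eventually each term is at least twice its predecessor \<open>b n\<close>, and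
  \<open>b n \<ge> n\<close>, so the gaps eventually exceed any given \<open>K\<close>. Such a set
  has at most about \<open>n / K\<close> elements up to \<open>n\<close>.\<close>

lemma has_density_zero_sparse:
  fixes b :: "nat \<Rightarrow> nat"
  assumes b: "strict_mono b" and sparse: "(\<lambda>n. real (b n) / real (b (Suc n))) \<longlonglongrightarrow> 0"
  shows "has_density (range b) 0"
proof (rule has_density_zeroI)
  fix \<epsilon> :: real
  assume "\<epsilon> > 0"
  obtain K :: nat where K: "real K > 1 / \<epsilon>" using reals_Archimedean2 by blast
  obtain N where N: "\<And>n. n \<ge> N \<Longrightarrow> real (b n) / real (b (Suc n)) < 1 / 2"
    using order_tendstoD(2)[OF sparse, of "1/2"] unfolding eventually_sequentially by auto
  define N' where "N' = max N K"
  have gap: "b (Suc n) \<ge> b n + K" if "n \<ge> N'" for n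
  proof -
    have "b (Suc n) > 0" using strict_monoD[OF b, of n "Suc n"] by simp
    then have "2 * b n \<le> b (Suc n)" using N[of n] that by (simp add: N'_def field_simps)
    moreover have "b n \<ge> n" using b by (rule strict_mono_imp_increasing)
    ultimately show ?thesis using that by (simp add: N'_def)
  qed
  have lin: "b (N' + i) \<ge> K * i" for i
  proof (induction i)
    case (Suc i)
    then show ?case using gap[of "N' + i"] by simp
  qed simp
  have "real (card (range b \<inter> {1..n})) \<le> \<epsilon> * real n + (real N' + 1)" for n
  proof -
    have "K > 0" using K \<open>\<epsilon> > 0\<close> by (cases K) (auto simp: field_simps)
    have "range b \<inter> {1..n} \<subseteq> b ` {..<N' + (n div K + 1)}"
    proof
      fix y assume "y \<in> range b \<inter> {1..n}"
      then obtain j where j: "y = b j" "b j \<le> n" by auto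
      have "j < N' + (n div K + 1)"
      proof (rule ccontr)
        assume "\<not> j < N' + (n div K + 1)"
        define i where "i = j - N'"
        have i: "j = N' + i" "i \<ge> n div K + 1"
          using \<open>\<not> j < N' + (n div K + 1)\<close> unfolding i_def by linarith+
        have "K * (n div K + 1) \<le> K * i" using i(2) by (rule mult_le_mono2)
        also have "\<dots> \<le> n" using lin[of i] i j by simp
        finally show False using dividend_less_times_div[OF \<open>K > 0\<close>, of n] by simp
      qed
      then show "y \<in> b ` {..<N' + (n div K + 1)}" using j by auto
    qed
    then have "card (range b \<inter> {1..n}) \<le> card {..<N' + (n div K + 1)}"
      by (rule surj_card_le[OF finite_lessThan])
    then have "card (range b \<inter> {1..n}) \<le> N' + (n div K + 1)" by simp
    moreover have "real (n div K) \<le> \<epsilon> * real n"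
    proof -
      have "real (n div K) \<le> real n / real K" by (rule of_nat_div_le_of_nat)
      also have "\<dots> \<le> \<epsilon> * real n"
        using K \<open>\<epsilon> > 0\<close> \<open>K > 0\<close> mult_right_mono[of 1 "\<epsilon> * real K" "real n"]
        by (simp add: field_simps)
      finally show ?thesis .
    qed
    ultimately show ?thesis by linarith
  qed
  then show "\<exists>C. \<forall>n. real (card (range b \<inter> {1..n})) \<le> \<epsilon> * real n + C" by blast
qed

text \<open>
  Take \<open>\<theta>\<close> to be the limit of \<open>x\<^sub>n\<close>, where \<open>x\<^sub>n\<^sub>+\<^sub>1\<close> is the least number above \<open>x\<^sub>n\<close> such that
  \<open>b\<^sub>n\<^sub>+\<^sub>1 x\<^sub>n\<^sub>+\<^sub>1\<close> is congruent to \<open>t\<^sub>n\<^sub>+\<^sub>1\<close> modulo \<open>1\<close>.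
\<close>

lemma sparse_simultaneous_approximation:
  fixes b t :: "nat \<Rightarrow> real"
  assumes pos: "\<And>n. b n > 0" and sparse: "(\<lambda>n. b n / b (Suc n)) \<longlonglongrightarrow> 0"
  obtains \<theta> :: real and m :: "nat \<Rightarrow> int"
  where "\<And>n. \<theta> * b n \<ge> t n + of_int (m n)"
    and "(\<lambda>n. \<theta> * b n - t n - of_int (m n)) \<longlonglongrightarrow> 0"
proof -
  define x where "x = rec_nat (t 0 / b 0)
    (\<lambda>n y. (of_int \<lceil>b (Suc n) * y - t (Suc n)\<rceil> + t (Suc n)) / b (Suc n))"
  have x_0: "x 0 = t 0 / b 0"
    and x_Suc: "\<And>n. x (Suc n) = (of_int \<lceil>b (Suc n) * x n - t (Suc n)\<rceil> + t (Suc n)) / b (Suc n)"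
    unfolding x_def by simp_all
  have "\<exists>m::int. x n * b n = t n + of_int m" for n
  proof (cases n)
    case 0
    then show ?thesis using pos[of 0] by (intro exI[of _ 0]) (simp add: x_0)
  next
    case (Suc k)
    then show ?thesis using pos[of n]
      by (intro exI[of _ "\<lceil>b (Suc k) * x k - t (Suc k)\<rceil>"]) (simp add: x_Suc)
  qed
  then obtain m :: "nat \<Rightarrow> int" where m: "\<And>n. x n * b n = t n + of_int (m n)" by metis
  have step: "x n \<le> x (Suc n)" "x (Suc n) \<le> x n + 1 / b (Suc n)" for n
  proof -
    define c where "c = of_int \<lceil>b (Suc n) * x n - t (Suc n)\<rceil> + t (Suc n)"
    have "b (Suc n) * x n \<le> c" "c \<le> b (Suc n) * x n + 1"
      unfolding c_def by linarith+
    moreover have "c = x (Suc n) * b (Suc n)"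
      unfolding x_Suc c_def using pos[of "Suc n"] by simp
    ultimately show "x n \<le> x (Suc n)" "x (Suc n) \<le> x n + 1 / b (Suc n)"
      using pos[of "Suc n"] by (simp_all add: field_simps)
  qed
  have "incseq x" using step(1) by (rule incseq_SucI)
  obtain N where N: "\<And>n. n \<ge> N \<Longrightarrow> b n / b (Suc n) < 1 / 2"
    using order_tendstoD(2)[OF sparse, of "1/2"] unfolding eventually_sequentially by auto
  \<comment> \<open>The sequence \<open>x n + 2 / b (Suc n)\<close> is nonincreasing from
    \<open>N\<close> on: a step raises \<open>x\<close> by at most \<open>1 / b (Suc n)\<close>,
    while the next correction term is at most half the old one.\<close>
  have bound: "x (n + i) + 2 / b (Suc (n + i)) \<le> x n + 2 / b (Suc n)" if "n \<ge> N" for n i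
  proof (induction i)
    case (Suc i)
    have "b (Suc (n + i)) / b (Suc (Suc (n + i))) < 1 / 2" using N that by simp
    then have "2 / b (Suc (Suc (n + i))) \<le> 1 / b (Suc (n + i))"
      using pos[of "Suc (n + i)"] pos[of "Suc (Suc (n + i))"] by (simp add: field_simps)
    with step(2)[of "n + i"] Suc show ?case by simp
  qed simp
  have le: "x j \<le> x n + 2 / b (Suc n)" if "n \<ge> N" for n j
  proof -
    have "x j \<le> x (n + j)" using \<open>incseq x\<close> by (simp add: incseq_def)
    then show ?thesis using bound[OF that, of j] pos[of "Suc (n + j)"]
      by (smt (verit) divide_pos_pos)
  qed
  obtain \<theta> where \<theta>: "x \<longlonglongrightarrow> \<theta>" "\<And>n. x n \<le> \<theta>"
    using incseq_convergent[OF \<open>incseq x\<close>] le[of N] by blast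
  have \<theta>_le: "\<theta> \<le> x n + 2 / b (Suc n)" if "n \<ge> N" for n
    using \<theta>(1) le[OF that] by (intro LIMSEQ_le_const2) auto
  have ge: "\<theta> * b n \<ge> t n + of_int (m n)" for n
    using m[of n] \<theta>(2)[of n] pos[of n] by (metis less_eq_real_def mult_right_mono)
  moreover have "(\<lambda>n. \<theta> * b n - t n - of_int (m n)) \<longlonglongrightarrow> 0"
  proof (rule tendsto_sandwich)
    show "\<forall>\<^sub>F n in sequentially. 0 \<le> \<theta> * b n - t n - of_int (m n)"
      using ge by (simp add: algebra_simps)
    \<comment> \<open>The limit exceeds \<open>x n\<close> by at most \<open>2 / b (Suc n)\<close>.
      Multiplied by \<open>b n\<close> this becomes a ratio that tends to 0 by sparseness.\<close>
    have "\<theta> * b n - t n - of_int (m n) \<le> 2 * (b n / b (Suc n))" if "n \<ge> N" for n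
    proof -
      have "\<theta> * b n \<le> (x n + 2 / b (Suc n)) * b n"
        using \<theta>_le[OF that] pos[of n] by (simp add: mult_right_mono)
      then show ?thesis using m[of n] by (simp add: algebra_simps)
    qed
    then show "\<forall>\<^sub>F n in sequentially. \<theta> * b n - t n - of_int (m n) \<le> 2 * (b n / b (Suc n))"
      unfolding eventually_sequentially by blast
    show "(\<lambda>n. 2 * (b n / b (Suc n))) \<longlonglongrightarrow> 0"
      using tendsto_mult_left[OF sparse, of 2] by simp
  qed simp
  ultimately show ?thesis using that by blast
qed

text \<open>The rationals in (0, \<alpha>) are enumerated through the first component of
  \<open>prod_decode\<close>, so that each recurs at arbitrarily large indices.\<close>

lemma dense_sequence_below:
  fixes \<alpha> :: real
  assumes "\<alpha> > 0"
  obtains t :: "nat \<Rightarrow> real"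
  where "\<And>n. 0 < t n" "\<And>n. t n < \<alpha>"
    and "\<And>u v N. \<lbrakk>0 \<le> u; u < v; v \<le> \<alpha>\<rbrakk> \<Longrightarrow> \<exists>n\<ge>N. u < t n \<and> t n < v"
proof -
  define S where "S = {q \<in> \<rat>. 0 < q \<and> q < \<alpha>}"
  have "S \<noteq> {}" using Rats_dense_in_real[OF assms] unfolding S_def by auto
  moreover have "countable S" unfolding S_def using countable_rat by (rule countable_subset[rotated]) auto
  ultimately have rng: "range (from_nat_into S) = S" by (rule range_from_nat_into)
  define t where "t = (\<lambda>n. from_nat_into S (fst (prod_decode n)))"
  have S: "t n \<in> S" for n unfolding t_def using rng by blast
  have "\<exists>n\<ge>N. u < t n \<and> t n < v" if uv: "0 \<le> u" "u < v" "v \<le> \<alpha>" for u v N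
  proof -
    obtain q where "q \<in> \<rat>" "u < q" "q < v" using Rats_dense_in_real[OF uv(2)] by blast
    with uv have "q \<in> S" unfolding S_def by auto
    then obtain i where i: "q = from_nat_into S i" using rng by blast
    have "t (prod_encode (i, N)) = q" unfolding t_def i by simp
    with \<open>u < q\<close> \<open>q < v\<close> show ?thesis
      by (intro exI[of _ "prod_encode (i, N)"]) (auto simp: le_prod_encode_2)
  qed
  with that[of t] S show ?thesis unfolding S_def by auto
qed


section \<open>Construction of A and the density of A + B\<close>

theorem corollary1p6:
  fixes B :: "nat set" and \<alpha> :: real
  assumes "B \<subseteq> {1..}" and "infinite B" and "highly_sparse B"
    and "\<alpha> \<in> {0..1}"
  shows "\<exists>A :: nat set. A \<subseteq> {1..} \<and> has_density A 0 \<and> has_density (A + B) \<alpha>"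
proof (cases "\<alpha> = 0")
  case True
  then show ?thesis
    by (intro exI[of _ "{}"]) (auto simp: has_density_def set_plus_def)
next
  case False
  with assms(4) have \<alpha>: "0 < \<alpha>" "\<alpha> \<le> 1" by auto
  define b where "b = enumerate B"
  have b_mono: "strict_mono b" unfolding b_def using assms(2) by (rule strict_mono_enumerate)
  have B_eq: "B = range b" unfolding b_def using assms(2) by (simp add: range_enumerate)
  have b_pos: "b n \<ge> 1" for n using assms(1) B_eq by auto
  have sparse: "(\<lambda>n. real (b n) / real (b (Suc n))) \<longlonglongrightarrow> 0"
    using assms(3) unfolding highly_sparse_def b_def by simp
  have B0: "has_density B 0"
    unfolding B_eq using b_mono sparse by (rule has_density_zero_sparse)
  obtain t :: "nat \<Rightarrow> real" where t: "\<And>n. 0 < t n" "\<And>n. t n < \<alpha>"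
    and t_dense: "\<And>u v N. \<lbrakk>0 \<le> u; u < v; v \<le> \<alpha>\<rbrakk> \<Longrightarrow> \<exists>n\<ge>N. u < t n \<and> t n < v"
    using dense_sequence_below[OF \<alpha>(1)] by blast
  obtain \<theta> :: real and m :: "nat \<Rightarrow> int"
    where \<theta>_ge: "\<And>n. \<theta> * real (b n) \<ge> t n + of_int (m n)"
      and \<theta>_lim: "(\<lambda>n. \<theta> * real (b n) - t n - of_int (m n)) \<longlonglongrightarrow> 0"
      proof (rule sparse_simultaneous_approximation[of "\<lambda>n. real (b n)" t])
    show "real (b n) > 0" for n using b_pos[of n] by simp
  qed (use sparse in auto)
  define g where "g = (\<lambda>n. frac (\<theta> * real n))"
  have g: "0 \<le> g n" "g n < 1" for n unfolding g_def by (auto simp: frac_lt_1)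
  have close: "\<exists>N. \<forall>n\<ge>N. \<theta> * real (b n) - t n - of_int (m n) < \<epsilon>" if "\<epsilon> > 0" for \<epsilon>
    using order_tendstoD(2)[OF \<theta>_lim that] unfolding eventually_sequentially .
  \<comment> \<open>Picking \<open>t n\<close> in the lower half of \<open>(u, v)\<close> leaves
    room for the nonnegative error, which is less than half the length.\<close>
  have dense: "\<exists>n. u < g (b n) \<and> g (b n) < v" if uv: "0 \<le> u" "u < v" "v \<le> \<alpha>" for u v
  proof -
    obtain N where N: "\<And>n. n \<ge> N \<Longrightarrow> \<theta> * real (b n) - t n - of_int (m n) < (v - u) / 2"
      using close[of "(v - u) / 2"] uv by auto
    obtain n where n: "n \<ge> N" "u < t n" "t n < (u + v) / 2"
      using t_dense[of u "(u + v) / 2" N] uv by auto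
    define y where "y = \<theta> * real (b n) - of_int (m n)"
    have y: "u < y" "y < v"
      using N[OF n(1)] n \<theta>_ge[of n] unfolding y_def by (simp_all add: field_simps)
    then have "g (b n) = y"
      unfolding g_def using uv \<alpha> by (intro frac_eqI) (auto simp: y_def)
    with y show ?thesis by auto
  qed
  have small: "\<exists>k::nat. 0 < frac (\<theta> * real k) \<and> frac (\<theta> * real k) < \<epsilon>" if \<epsilon>: "\<epsilon> > 0" for \<epsilon>
  proof -
    obtain n where "0 < g (b n)" "g (b n) < min \<epsilon> \<alpha>"
      using dense[of 0 "min \<epsilon> \<alpha>"] \<epsilon> \<alpha> by auto
    then show ?thesis unfolding g_def by auto
  qed
  have density_g: "has_density {y. g y < \<beta>} \<beta>" if "0 \<le> \<beta>" "\<beta> \<le> 1" for \<beta>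
    unfolding g_def using small that by (rule has_density_frac_less)

  \<comment> \<open>Finitely many \<open>b n\<close> are \<open>1 / (k + 1)\<close>-dense in (0,
    \<alpha>), and \<open>M\<close> exceeds them all. The requirement \<open>M \<ge> k\<close>
    ensures that only finitely many thresholds lie below a given number.\<close>
  have "\<exists>M\<ge>k. \<forall>s. 1 / real (Suc k) \<le> s \<and> s < \<alpha> \<longrightarrow>
      (\<exists>n. b n < M \<and> s - 1 / real (Suc k) < g (b n) \<and> g (b n) \<le> s)" for k
  proof -
    \<comment> \<open>With cells of half the required length, the window of length
      \<open>2 * d\<close> ending at \<open>s\<close> contains a whole cell, namely the one ending
      at the largest multiple of \<open>d\<close> not above \<open>s\<close>.\<close>
    define d where "d = 1 / (2 * real (Suc k))"
    have "d > 0" and d2: "1 / real (Suc k) = 2 * d" unfolding d_def by (simp_all add: field_simps)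
    have "\<exists>n. real (Suc i) * d \<le> \<alpha> \<longrightarrow> real i * d < g (b n) \<and> g (b n) < real (Suc i) * d" for i :: nat
      using dense[of "real i * d" "real (Suc i) * d"] \<open>d > 0\<close> by (auto simp: algebra_simps)
    then obtain n where n: "\<And>i. real (Suc i) * d \<le> \<alpha> \<Longrightarrow>
        real i * d < g (b (n i)) \<and> g (b (n i)) < real (Suc i) * d" by metis
    define M where "M = k + 1 + (\<Sum>i\<le>2 * Suc k. b (n i))"
    have "\<exists>n. b n < M \<and> s - 1 / real (Suc k) < g (b n) \<and> g (b n) \<le> s"
      if s: "1 / real (Suc k) \<le> s" "s < \<alpha>" for s
    proof -
      define j where "j = nat \<lfloor>s / d\<rfloor>"
      have "s \<ge> 2 * d" using s unfolding d2 by simp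
      then have "s / d \<ge> 2" using \<open>d > 0\<close> by (simp add: field_simps)
      then have j: "real j \<le> s / d" "s / d < real j + 1" "j \<ge> 2"
        unfolding j_def by linarith+
      then obtain i where i: "j = Suc i" by (cases j) auto
      have js: "real (Suc i) * d \<le> s" "s < real (Suc i) * d + d"
        using j \<open>d > 0\<close> unfolding i by (auto simp: field_simps)
      have "real (Suc i) * d \<le> 1" using js s \<alpha> by linarith
      then have "Suc i \<le> 2 * Suc k" unfolding d_def by (simp add: field_simps)
      then have "b (n i) \<le> (\<Sum>i\<le>2 * Suc k. b (n i))"
        by (intro member_le_sum) auto
      then have "b (n i) < M" unfolding M_def by simp
      moreover have "real i * d < g (b (n i))" "g (b (n i)) < real (Suc i) * d"
        using n[of i] js s by auto
      ultimately show ?thesis unfolding d2 using js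
        by (intro exI[of _ "n i"]) (auto simp: algebra_simps)
    qed
    moreover have "M \<ge> k" unfolding M_def by simp
    ultimately show ?thesis by blast
  qed
  then obtain M :: "nat \<Rightarrow> nat" where M_ge: "\<And>k. M k \<ge> k"
    and M: "\<And>k s. \<lbrakk>1 / real (Suc k) \<le> s; s < \<alpha>\<rbrakk> \<Longrightarrow>
      \<exists>n. b n < M k \<and> s - 1 / real (Suc k) < g (b n) \<and> g (b n) \<le> s" by metis

  \<comment> \<open>This encodes \<open>g x < \<delta>(x)\<close>, where \<open>\<delta>(x)\<close>
    is the least \<open>1 / (k + 1)\<close> over the \<open>k\<close> with
    \<open>M k \<le> x\<close>; no condition is imposed on \<open>g x\<close> if there is no such
    \<open>k\<close>.\<close>
  define A where "A = {x. 1 \<le> x \<and> (\<forall>k. M k \<le> x \<longrightarrow> g x < 1 / real (Suc k))}"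
  have A_pos: "A \<subseteq> {1..}" unfolding A_def by auto
  have A0: "has_density A 0"
  proof (rule has_density_zeroI)
    fix \<epsilon> :: real
    assume "\<epsilon> > 0"
    obtain k where k: "1 / real (Suc k) < \<epsilon> / 2"
      using nat_approx_posE[of "\<epsilon> / 2"] \<open>\<epsilon> > 0\<close> by auto
    obtain C where C: "\<And>n. \<bar>real (card ({y. g y < 1 / real (Suc k)} \<inter> {1..n})) - 1 / real (Suc k) * real n\<bar>
        \<le> \<epsilon> / 2 * real n + C"
      using has_densityD[OF density_g[of "1 / real (Suc k)"], of "\<epsilon> / 2"] \<open>\<epsilon> > 0\<close> by auto
    have "real (card (A \<inter> {1..n})) \<le> \<epsilon> * real n + (C + real (M k))" for n
    proof -
      have "A \<inter> {1..n} \<subseteq> ({y. g y < 1 / real (Suc k)} \<inter> {1..n}) \<union> {..<M k}"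
        unfolding A_def by (auto simp: not_less)
      then have "card (A \<inter> {1..n}) \<le> card (({y. g y < 1 / real (Suc k)} \<inter> {1..n}) \<union> {..<M k})"
        by (intro card_mono) auto
      also have "\<dots> \<le> card ({y. g y < 1 / real (Suc k)} \<inter> {1..n}) + M k"
        using card_Un_le[of _ "{..<M k}"] by simp
      finally have "real (card (A \<inter> {1..n})) \<le> 1 / real (Suc k) * real n + \<epsilon> / 2 * real n + C + real (M k)"
        using C[of n] by linarith
      moreover have "1 / real (Suc k) * real n \<le> \<epsilon> / 2 * real n"
        using k by (intro mult_right_mono) auto
      moreover have "\<epsilon> * real n = \<epsilon> / 2 * real n + \<epsilon> / 2 * real n" by simp
      ultimately show ?thesis by linarith
    qed
    then show "\<exists>C. \<forall>n. real (card (A \<inter> {1..n})) \<le> \<epsilon> * real n + C" by blast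
  qed

  have mem: "y \<in> A + B" if y: "M k \<le> y" "1 / real (Suc k) \<le> g y" "g y < \<alpha>" for k y
  proof -
    define S where "S = {k. M k \<le> y}"
    have "finite S" using M_ge by (intro finite_subset[of S "{..y}"]) (auto simp: S_def intro: order_trans)
    \<comment> \<open>The largest threshold index at \<open>y\<close> serves twice. Some
      \<open>b n < M K \<le> y\<close> lies within \<open>1 / (K + 1)\<close> below \<open>y\<close>
      in fractional part, and every condition imposed on the smaller number \<open>y - b n\<close>
      has index at most \<open>K\<close>.\<close>
    define K where "K = Max S"
    have "k \<in> S" using y unfolding S_def by simp
    then have "K \<in> S" "k \<le> K"
      unfolding K_def using \<open>finite S\<close> by (blast intro: Max_in Max_ge)+
    have Kk: "1 / real (Suc K) \<le> 1 / real (Suc k)" using \<open>k \<le> K\<close> by (simp add: frac_le)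
    obtain n where n: "b n < M K" "g y - 1 / real (Suc K) < g (b n)" "g (b n) \<le> g y"
      using M[of K "g y"] y Kk by auto
    have "b n < y" using n \<open>K \<in> S\<close> unfolding S_def by auto
    have "\<theta> * real (y - b n) - (g y - g (b n)) = of_int (\<lfloor>\<theta> * real y\<rfloor> - \<lfloor>\<theta> * real (b n)\<rfloor>)"
      using \<open>b n < y\<close> unfolding g_def by (simp add: frac_def of_nat_diff algebra_simps)
    then have "g (y - b n) = g y - g (b n)"
      using n(3) g[of y] g[of "b n"]
      by (subst g_def, intro frac_eqI) auto
    then have less: "g (y - b n) < 1 / real (Suc K)" using n by simp
    have "y - b n \<in> A"
      unfolding A_def
    proof (intro CollectI conjI allI impI)
      fix j assume "M j \<le> y - b n"
      then have "j \<in> S" unfolding S_def by simp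
      then have "j \<le> K" unfolding K_def using \<open>finite S\<close> by simp
      then have "1 / real (Suc K) \<le> 1 / real (Suc j)" by (simp add: frac_le)
      with less show "g (y - b n) < 1 / real (Suc j)" by simp
    qed (use \<open>b n < y\<close> in simp)
    moreover have "b n \<in> B" unfolding B_eq by simp
    moreover have "y = (y - b n) + b n" using \<open>b n < y\<close> by simp
    ultimately show ?thesis by (metis set_plus_intro)
  qed

  have "has_density (A + B) \<alpha>"
  proof (rule has_densityI)
    fix \<epsilon> :: real
    assume "\<epsilon> > 0"
    show "\<exists>C. \<forall>n. (\<alpha> - \<epsilon>) * real n - C \<le> real (card ((A + B) \<inter> {1..n}))"
    proof -
      obtain k where k: "1 / real (Suc k) < \<epsilon> / 3"
        using nat_approx_posE[of "\<epsilon> / 3"] \<open>\<epsilon> > 0\<close> by auto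
      define \<delta> where "\<delta> = 1 / real (Suc k)"
      have \<delta>: "0 \<le> \<delta>" "\<delta> \<le> 1" unfolding \<delta>_def by auto
      obtain C where C: "\<And>n. \<bar>real (card ({y. g y < \<alpha>} \<inter> {1..n})) - \<alpha> * real n\<bar> \<le> \<epsilon> / 3 * real n + C"
        using has_densityD[OF density_g[of \<alpha>], of "\<epsilon> / 3"] \<open>\<epsilon> > 0\<close> \<alpha> by auto
      obtain D where D: "\<And>n. \<bar>real (card ({y. g y < \<delta>} \<inter> {1..n})) - \<delta> * real n\<bar> \<le> \<epsilon> / 3 * real n + D"
        using has_densityD[OF density_g[of \<delta>], of "\<epsilon> / 3"] \<open>\<epsilon> > 0\<close> \<delta> by auto
      have "(\<alpha> - \<epsilon>) * real n - (C + D + real (M k)) \<le> real (card ((A + B) \<inter> {1..n}))" for n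
      proof -
        \<comment> \<open>By \<open>mem\<close>, an element with \<open>g y < \<alpha>\<close> can
          be missing from \<open>A + B\<close> only if \<open>g y < \<delta>\<close> or
          \<open>y < M k\<close>.\<close>
        have "{y. g y < \<alpha>} \<inter> {1..n} \<subseteq>
            ((A + B) \<inter> {1..n}) \<union> (({y. g y < \<delta>} \<inter> {1..n}) \<union> {..<M k})"
          using mem[of k, folded \<delta>_def] by (auto simp flip: not_le)
        then have "card ({y. g y < \<alpha>} \<inter> {1..n}) \<le>
            card (((A + B) \<inter> {1..n}) \<union> (({y. g y < \<delta>} \<inter> {1..n}) \<union> {..<M k}))"
          by (intro card_mono) auto
        also have "\<dots> \<le> card ((A + B) \<inter> {1..n}) + (card ({y. g y < \<delta>} \<inter> {1..n}) + card {..<M k})"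
          by (intro order_trans[OF card_Un_le] add_left_mono card_Un_le)
        finally have "real (card ({y. g y < \<alpha>} \<inter> {1..n})) \<le>
            real (card ((A + B) \<inter> {1..n})) + real (card ({y. g y < \<delta>} \<inter> {1..n})) + real (M k)"
          by simp
        moreover have "\<delta> * real n \<le> \<epsilon> / 3 * real n"
          using k unfolding \<delta>_def by (intro mult_right_mono) auto
        moreover have "(\<alpha> - \<epsilon>) * real n = \<alpha> * real n - 3 * (\<epsilon> / 3 * real n)"
          by (simp add: algebra_simps)
        ultimately show ?thesis using C[of n] D[of n] by linarith
      qed
      then show ?thesis by blast
    qed
    show "\<exists>C. \<forall>n. real (card ((A + B) \<inter> {1..n})) \<le> (\<alpha> + \<epsilon>) * real n + C"
    \<comment> \<open>In the first case treated the trivial bound \<open>n\<close> suffices. In the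
      other, \<open>\<alpha> + 2 * \<eta> < 1\<close>, so adding fractional parts does not wrap
      around.\<close>
    proof (cases "\<alpha> + \<epsilon> \<le> 1")
      case False
      have "real (card ((A + B) \<inter> {1..n})) \<le> (\<alpha> + \<epsilon>) * real n + 0" for n
      proof -
        have "card ((A + B) \<inter> {1..n}) \<le> card {1..n}" by (intro card_mono) auto
        then have "real (card ((A + B) \<inter> {1..n})) \<le> 1 * real n" by simp
        also have "\<dots> \<le> (\<alpha> + \<epsilon>) * real n" using False by (intro mult_right_mono) auto
        finally show ?thesis by simp
      qed
      then show ?thesis by blast
    next
      case True
      define \<eta> where "\<eta> = \<epsilon> / 4"
      have "\<eta> > 0" using \<open>\<epsilon> > 0\<close> unfolding \<eta>_def by simp
      obtain k where k: "1 / real (Suc k) < \<eta>"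
        using nat_approx_posE[OF \<open>\<eta> > 0\<close>] by auto
      obtain N where N: "\<And>n. n \<ge> N \<Longrightarrow> \<theta> * real (b n) - t n - of_int (m n) < \<eta>"
        using close[OF \<open>\<eta> > 0\<close>] by auto
      \<comment> \<open>The sums with a small index \<open>j\<close> or a small summand
        \<open>x\<close> lie in finitely many translates of \<open>A\<close> and \<open>B\<close>,
        both of density 0.\<close>
      define Z where "Z = (\<Union>i<N. (\<lambda>x. x + b i) ` A) \<union> (\<Union>x<M k. (\<lambda>y. y + x) ` B)"
      have Z0: "has_density Z 0"
        unfolding Z_def using A0 B0 A_pos assms(1)
        by (intro has_density_zero_Un has_density_zero_UN has_density_zero_translate) auto
      have sub: "A + B \<subseteq> {y. g y < \<alpha> + 2 * \<eta>} \<union> Z"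
      proof
        fix y assume "y \<in> A + B"
        then obtain x j where xj: "y = x + b j" "x \<in> A" unfolding B_eq by (auto elim!: set_plus_elim)
        show "y \<in> {y. g y < \<alpha> + 2 * \<eta>} \<union> Z"
        proof (cases "j < N \<or> x < M k")
          case True
          moreover have "y \<in> (\<lambda>x. x + b j) ` A" "y \<in> (\<lambda>y. y + x) ` B"
            unfolding B_eq using xj by auto
          ultimately have "y \<in> Z" unfolding Z_def by blast
          then show ?thesis by simp
        next
          case False
          \<comment> \<open>Approximation from above makes \<open>e\<close> a nonnegative
            representative of \<open>\<theta> * b j\<close> modulo 1, so \<open>g x + e\<close> lies
            in \<open>[0, 1)\<close> and equals \<open>g y\<close>.\<close>
          define e where "e = \<theta> * real (b j) - of_int (m j)"
          have e: "0 \<le> e" "e < \<alpha> + \<eta>"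
            using N[of j] False \<theta>_ge[of j] t[of j] unfolding e_def by linarith+
          have "g x < 1 / real (Suc k)" using xj(2) False unfolding A_def not_less de_Morgan_disj by blast
          with k have x: "g x < \<eta>" by simp
          have "\<theta> * real y - (g x + e) = of_int (\<lfloor>\<theta> * real x\<rfloor> + m j)"
            unfolding g_def e_def xj(1) by (simp add: frac_def algebra_simps)
          then have "g y = g x + e"
            using e x g[of x] \<open>\<alpha> + \<epsilon> \<le> 1\<close> \<open>\<eta> > 0\<close>
            by (subst g_def, intro frac_eqI) (auto simp: \<eta>_def)
          then show ?thesis using e x by simp
        qed
      qed
      obtain C where C: "\<And>n. \<bar>real (card ({y. g y < \<alpha> + 2 * \<eta>} \<inter> {1..n})) - (\<alpha> + 2 * \<eta>) * real n\<bar> \<le> \<eta> * real n + C"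
        using has_densityD[OF density_g[of "\<alpha> + 2 * \<eta>"] \<open>\<eta> > 0\<close>] \<alpha> \<open>\<eta> > 0\<close> True
        unfolding \<eta>_def by auto
      obtain D where D: "\<And>n. \<bar>real (card (Z \<inter> {1..n})) - 0 * real n\<bar> \<le> \<eta> * real n + D"
        using has_densityD[OF Z0 \<open>\<eta> > 0\<close>] by blast
      have "real (card ((A + B) \<inter> {1..n})) \<le> (\<alpha> + \<epsilon>) * real n + (C + D)" for n
      proof -
        have "card ((A + B) \<inter> {1..n}) \<le> card (({y. g y < \<alpha> + 2 * \<eta>} \<inter> {1..n}) \<union> (Z \<inter> {1..n}))"
          using sub by (intro card_mono) auto
        also have "\<dots> \<le> card ({y. g y < \<alpha> + 2 * \<eta>} \<inter> {1..n}) + card (Z \<inter> {1..n})"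
          by (rule card_Un_le)
        finally have "real (card ((A + B) \<inter> {1..n})) \<le>
            (\<alpha> + 2 * \<eta>) * real n + \<eta> * real n + \<eta> * real n + (C + D)"
          using C[of n] D[of n] by linarith
        then show ?thesis unfolding \<eta>_def by (simp add: field_simps)
      qed
      then show ?thesis by blast
    qed
  qed
  with A_pos A0 show ?thesis by blast
qed

end
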